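(* There exists an absolute constant $C>0$ such that the following holds. Fix $\varepsilon>0$, $\delta\in(0,1)$ and $\sigma>0$. Let $G$ be a stable discrete-time SISO LTI system with stability radius $\rho\in(0,1)$, let $r\ge1$ be an integer with $r\ge R(\varepsilon/2)$, and set $T=2r$. Let $m=2n$ be an even integer with $m\ge 4r$ and $$ m\ \ge\ C\,\frac{\sigma^2}{\varepsilon^2}\left(\log r+\log\left(\frac1\delta\right)\right), $$ and take as the $m$ inputs the vectors $u^{(\mathrm c)}_i,u^{(\mathrm s)}_i\in\mathbb{R}^T$, $i=0,\dots,n-1$, with entries $$u^{(\mathrm c)}_{i,t}=\cos\left(\frac{2\pi i t}{n}\right),\qquad u^{(\mathrm s)}_{i,t}=\sin\left(\frac{2\pi i t}{n}\right),\qquad t=0,\dots,T-1$$ (which lie in the constraint set $\mathcal{U}=\{x\in\mathbb{R}^T:\|x\|_\infty\le1\}$). Let $\widehat G_r$ be the length-$r$ FIR least-squares estimate computed from the $m$ independent noisy measurements corresponding to these inputs. Then, with probability at least $1-\delta$, $\|G-\widehat G_r\|_\infty\le\varepsilon$.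
   Context: System: $G(z)=\sum_{k\ge0}g_kz^{-k}$ with real impulse response $g=(g_k)_{k\ge0}$; "stable with stability radius $\rho\in(0,1)$" means $G$ is analytic on $\{|z|>\rho\}$ (all poles lie in $|z|\le\rho$). For a function $H$ analytic outside and continuous up to the unit circle $\mathbb{T}$, $\|H\|_\infty=\sup_{z\in\mathbb{T}}|H(z)|$ (the $\mathcal{H}_\infty$-norm); in particular $\|G(\gamma z)\|_\infty=\sup_{|z|=1}|G(\gamma z)|$. Sufficient length: for $\varepsilon>0$, $R(\varepsilon)$ is the smallest integer satisfying $$R(\varepsilon)\ \ge\ \inf_{\rho<\gamma<1}\frac{1}{1-\gamma}\log\left(\frac{\|G(\gamma z)\|_\infty}{\varepsilon(1-\gamma)}\right)$$ (with $\log 0=-\infty$; for an integer $r$, the condition $r\ge R(\varepsilon)$ just means that $r$ is at least this infimum). Measurements: for an input $u\in\mathbb{R}^T$ (indexed $0,\dots,T-1$) one observes $Y_{u,T}=((g\ast u)_k)_{k=0}^{T-1}+\xi\in\mathbb{R}^T$, with $\xi\sim N(0,\sigma^2I_T)$; noises of different measurements are independent. Estimator: $\mathrm{Toep}(u)$ is the $T\times T$ lower-triangular Toeplitz matrix with first column $u$. Listing the inputs as $u_1,\dots,u_m$, with $Z\in\mathbb{R}^{Tm\times T}$ obtained by stacking $\mathrm{Toep}(u_1),\dots,\mathrm{Toep}(u_m)$ vertically and $Y=(Y_{u_1,T},\dots,Y_{u_m,T})\in\mathbb{R}^{Tm}$, put $(\widehat g_0,\dots,\widehat g_{T-1})^{\top}=(Z^{\top}Z)^{-1}Z^{\top}Y$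 and $\widehat G_r(z)=\sum_{k=0}^{r-1}\widehat g_kz^{-k}$. *)

theory Defs
  imports
    "HOL-Probability.Probability"
    "Jordan_Normal_Form.Gauss_Jordan_Elimination"
begin

unbundle no vec_syntax
hide_const (open) Finite_Cartesian_Product.vec Finite_Cartesian_Product.mat

section \<open>Systems\<close>

text \<open>
  The identity G(z) = sum of g k * z^(-k) is only required near infinity, where it defines the
  transfer function. Convergence on the larger region in which G is analytic is a consequence
  of analyticity.
\<close>

definition has_impulse_response :: "(complex \<Rightarrow> complex) \<Rightarrow> (nat \<Rightarrow> real) \<Rightarrow> bool" where
  "has_impulse_response G g \<longleftrightarrow>
     (\<exists>R. \<forall>z. cmod z > R \<longrightarrow> (\<lambda>k. complex_of_real (g k) * z powi (- int k)) sums G z)"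

definition stable_system :: "(complex \<Rightarrow> complex) \<Rightarrow> (nat \<Rightarrow> real) \<Rightarrow> real \<Rightarrow> bool" where
  "stable_system G g \<rho> \<longleftrightarrow> has_impulse_response G g \<and> G analytic_on {z. cmod z > \<rho>}"

definition hinf_norm :: "(complex \<Rightarrow> complex) \<Rightarrow> real" where
  "hinf_norm H = (SUP z\<in>sphere 0 1. cmod (H z))"

section \<open>Sufficient length\<close>

definition ext_ln :: "real \<Rightarrow> ereal" where
  "ext_ln x = (if x = 0 then -\<infinity> else ereal (ln x))"

definition length_bound :: "(complex \<Rightarrow> complex) \<Rightarrow> real \<Rightarrow> real \<Rightarrow> ereal" where
  "length_bound G \<rho> \<epsilon> =
     (INF \<gamma>\<in>{\<rho><..<1}. ereal (1 / (1 - \<gamma>)) *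
        ext_ln (hinf_norm (\<lambda>z. G (complex_of_real \<gamma> * z)) / (\<epsilon> * (1 - \<gamma>))))"

text \<open>
  The smallest integer above the bound. It is extended-real valued because the bound is
  \<open>-\<infinity>\<close> for the zero system, and then every integer is sufficient. In the remaining cases the
  infimum over the integers is attained.
\<close>

definition sufficient_length :: "(complex \<Rightarrow> complex) \<Rightarrow> real \<Rightarrow> real \<Rightarrow> ereal" where
  "sufficient_length G \<rho> \<epsilon> =
     (INF k\<in>{k::int. length_bound G \<rho> \<epsilon> \<le> ereal (of_int k)}. ereal (of_int k))"

section \<open>Measurements\<close>

text \<open>Inputs are vectors of length T, extended by zero in the convolution.\<close>

definition measurement :: "(nat \<Rightarrow> real) \<Rightarrow> nat \<Rightarrow> real vec \<Rightarrow> (nat \<Rightarrow> real) \<Rightarrow> real vec" where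
  "measurement g T u \<xi> = vec T (\<lambda>k. (\<Sum>j\<le>k. g j * u $ (k - j)) + \<xi> k)"

text \<open>The law of a Gaussian vector in dimension T with mean 0 and covariance \<open>\<sigma>\<^sup>2\<close> times identity.\<close>

definition gaussian_noise :: "nat \<Rightarrow> real \<Rightarrow> (nat \<Rightarrow> real) measure" where
  "gaussian_noise T \<sigma> = (\<Pi>\<^sub>M t\<in>{..<T}. density lborel (\<lambda>x. ennreal (normal_density 0 \<sigma> x)))"

text \<open>The joint law of the noises of m independent measurements.\<close>

definition noise_law :: "nat \<Rightarrow> nat \<Rightarrow> real \<Rightarrow> (nat \<Rightarrow> nat \<Rightarrow> real) measure" where
  "noise_law m T \<sigma> = (\<Pi>\<^sub>M a\<in>{..<m}. gaussian_noise T \<sigma>)"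

section \<open>Least-squares estimator\<close>

definition Toep :: "nat \<Rightarrow> real vec \<Rightarrow> real mat" where
  "Toep T u = mat T T (\<lambda>(i, j). if j \<le> i then u $ (i - j) else 0)"

definition stacked_Toep :: "nat \<Rightarrow> real vec list \<Rightarrow> real mat" where
  "stacked_Toep T us = mat (T * length us) T (\<lambda>(p, j). Toep T (us ! (p div T)) $$ (p mod T, j))"

definition stacked_measurements ::
    "(nat \<Rightarrow> real) \<Rightarrow> nat \<Rightarrow> real vec list \<Rightarrow> (nat \<Rightarrow> nat \<Rightarrow> real) \<Rightarrow> real vec" where
  "stacked_measurements g T us \<omega> =
     vec (T * length us) (\<lambda>p. measurement g T (us ! (p div T)) (\<omega> (p div T)) $ (p mod T))"

definition least_squares :: "real mat \<Rightarrow> real vec \<Rightarrow> real vec" where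
  "least_squares Z Y = (the (mat_inverse (transpose_mat Z * Z)) * transpose_mat Z) *\<^sub>v Y"

definition fir :: "nat \<Rightarrow> real vec \<Rightarrow> complex \<Rightarrow> complex" where
  "fir r h z = (\<Sum>k<r. complex_of_real (h $ k) * z powi (- int k))"

definition fir_estimate ::
    "(nat \<Rightarrow> real) \<Rightarrow> nat \<Rightarrow> nat \<Rightarrow> real vec list \<Rightarrow> (nat \<Rightarrow> nat \<Rightarrow> real) \<Rightarrow> complex \<Rightarrow> complex" where
  "fir_estimate g r T us \<omega> =
     fir r (least_squares (stacked_Toep T us) (stacked_measurements g T us \<omega>))"

section \<open>Inputs\<close>

definition cos_input :: "nat \<Rightarrow> nat \<Rightarrow> nat \<Rightarrow> real vec" where
  "cos_input n T i = vec T (\<lambda>t. cos (2 * pi * real i * real t / real n))"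

definition sin_input :: "nat \<Rightarrow> nat \<Rightarrow> nat \<Rightarrow> real vec" where
  "sin_input n T i = vec T (\<lambda>t. sin (2 * pi * real i * real t / real n))"

definition harmonic_inputs :: "nat \<Rightarrow> nat \<Rightarrow> real vec list" where
  "harmonic_inputs n T = map (cos_input n T) [0..<n] @ map (sin_input n T) [0..<n]"

definition linf_ball :: "nat \<Rightarrow> real vec set" where
  "linf_ball T = {x \<in> carrier_vec T. \<forall>t<T. \<bar>x $ t\<bar> \<le> 1}"

end

theory Submission
  imports
    Defs
    "HOL-Complex_Analysis.Complex_Analysis"
    "Jordan_Normal_Form.Determinant"
begin

unbundle no vec_syntax
no_notation fps_nth (infixl "$" 75)
hide_const (open) Finite_Cartesian_Product.vec Finite_Cartesian_Product.mat

text \<open>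
  Cauchy's estimate for \<open>w \<mapsto> G (1/w)\<close> gives the decay \<open>\<bar>g k\<bar> \<le> \<parallel>G(\<gamma>z)\<parallel> \<gamma>\<^sup>k\<close>, so the length condition
  makes the truncation error at most \<open>\<epsilon>/2\<close>. For the harmonic inputs the matrix \<open>Z\<^sup>T Z\<close> is diagonal
  with entries \<open>n (T - j) \<ge> n r\<close>, hence every linear form in the \<open>r\<close> estimation errors whose
  coefficients are at most 1 is a centered Gaussian of variance at most \<open>\<sigma>\<^sup>2 / n\<close>. The error polynomial
  has supremum norm at most a constant times the maximum of \<open>r\<^sup>4\<close> such forms, and each of them is
  small except with probability \<open>(\<delta>/r)\<^sup>4\<close>.
\<close>

section \<open>Truncation error\<close>

text \<open>A real-valued \<open>SUP\<close> bounds its members only if the set is bounded above.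
  Continuity on the compact circle supplies this.\<close>

lemma cmod_le_hinf_norm:
  assumes "continuous_on (sphere 0 1) H" "cmod z = 1"
  shows "cmod (H z) \<le> hinf_norm H"
  unfolding hinf_norm_def
proof (rule cSUP_upper)
  show "bdd_above ((\<lambda>z. cmod (H z)) ` sphere 0 1)"
    by (intro bounded_imp_bdd_above compact_imp_bounded compact_continuous_image
        continuous_on_norm assms compact_sphere)
qed (use assms in auto)

lemma hinf_norm_le_iff:
  assumes "continuous_on (sphere 0 1) H"
  shows "hinf_norm H \<le> b \<longleftrightarrow> (\<forall>z\<in>sphere 0 1. cmod (H z) \<le> b)"
proof
  assume "hinf_norm H \<le> b"
  then show "\<forall>z\<in>sphere 0 1. cmod (H z) \<le> b"
    using cmod_le_hinf_norm[OF assms] by force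
next
  assume "\<forall>z\<in>sphere 0 1. cmod (H z) \<le> b"
  moreover have "1 \<in> sphere (0::complex) 1"
    by simp
  ultimately show "hinf_norm H \<le> b"
    unfolding hinf_norm_def by (intro cSUP_least) blast+
qed

lemma stable_system_continuous_on:
  assumes "stable_system G g \<rho>" "S \<subseteq> {z. cmod z > \<rho>}"
  shows "continuous_on S G"
  using assms unfolding stable_system_def
  by (meson analytic_imp_holomorphic continuous_on_subset holomorphic_on_imp_continuous_on)

text \<open>The substitution \<open>w = 1/z\<close> moves infinity to 0 and makes theorems about
  holomorphic functions on discs applicable. Near 0 the function is the power series with
  coefficients \<open>g k\<close>, hence holomorphic there including 0. Away from 0 it is a
  composition with \<open>G\<close>. The two open sets together contain the disc of radius
  \<open>1 / \<rho>\<close>.\<close>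

lemma stable_system_disc:
  assumes G: "stable_system G g \<rho>" and \<rho>: "0 < \<rho>"
  obtains F where "F holomorphic_on ball 0 (1 / \<rho>)"
    and "\<And>w. w \<noteq> 0 \<Longrightarrow> F w = G (inverse w)"
    and "\<And>k. (deriv ^^ k) F 0 / fact k = complex_of_real (g k)"
proof -
  define F where "F = (\<lambda>w. if w = 0 then complex_of_real (g 0) else G (inverse w))"
  obtain R where R: "\<And>z. cmod z > R \<Longrightarrow> (\<lambda>k. complex_of_real (g k) * z powi (- int k)) sums G z"
    using G unfolding stable_system_def has_impulse_response_def by blast
  have Gan: "G analytic_on {z. cmod z > \<rho>}"
    using G unfolding stable_system_def by blast
  \<comment> \<open>If \<open>w\<close> is nonzero and \<open>cmod w < d\<close>, then
    \<open>1/w\<close> lies where the series for \<open>G\<close> converges. \<open>R\<close> may be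
    zero or negative, so the maximum with \<open>\<rho>\<close> keeps \<open>d\<close> positive; it
    also keeps the small disc inside the large one.\<close>
  define d where "d = inverse (max R \<rho>)"
  have d: "0 < d" "d \<le> 1 / \<rho>"
    using \<rho> by (auto simp: d_def field_simps)
  define f where "f = Abs_fps (\<lambda>k. complex_of_real (g k))"
  have Fs: "(\<lambda>k. fps_nth f k * w ^ k) sums F w" if w: "w \<in> ball 0 d" for w
  proof (cases "w = 0")
    case True
    then show ?thesis
      using sums_single[of 0 "\<lambda>k. complex_of_real (g k)"]
      by (simp add: F_def f_def power_0_left if_distrib cong: if_cong)
  next
    case False
    have "max R \<rho> < inverse (cmod w)"
      using w False \<rho> less_imp_inverse_less[of "cmod w" d] by (simp add: d_def)
    then have "cmod (inverse w) > R"
      by (simp add: norm_inverse)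
    from R[OF this] show ?thesis
      using False by (simp add: F_def f_def power_int_minus power_inverse)
  qed
  have "f = fps_expansion F 0"
  proof -
    have "eventually (\<lambda>w. w \<in> ball 0 d) (nhds (0::complex))"
      using d by (intro eventually_nhds_in_open) auto
    then have "F has_fps_expansion f"
      by (intro has_fps_expansionI) (auto elim!: eventually_mono intro: Fs)
    then show ?thesis
      using fps_expansion_eqI by metis
  qed
  then have derivF: "(deriv ^^ k) F 0 / fact k = complex_of_real (g k)" for k
    by (metis f_def fps_expansion_def fps_nth_Abs_fps)
  have "F holomorphic_on ball 0 d"
    using power_series_holomorphic[of 0 d "fps_nth f" F] Fs by simp
  moreover have "F holomorphic_on (ball 0 (1 / \<rho>) - {0})"
  proof -
    have "(\<lambda>w. G (inverse w)) holomorphic_on (ball 0 (1 / \<rho>) - {0})"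
    proof (rule holomorphic_on_compose_gen[of inverse _ G, unfolded o_def])
      show "G holomorphic_on {z. cmod z > \<rho>}"
        using Gan by (rule analytic_imp_holomorphic)
      show "inverse ` (ball 0 (1 / \<rho>) - {0}) \<subseteq> {z. cmod z > \<rho>}"
        using \<rho> by (auto simp: norm_divide field_simps)
    qed (auto intro!: holomorphic_intros)
    then show ?thesis
      by (rule holomorphic_transform) (auto simp: F_def)
  qed
  ultimately have "F holomorphic_on (ball 0 d \<union> (ball 0 (1 / \<rho>) - {0}))"
    by (intro holomorphic_on_Un) auto
  then have "F holomorphic_on ball 0 (1 / \<rho>)"
    by (rule holomorphic_on_subset) (use d in auto)
  then show thesis
    using derivF that[of F] by (simp add: F_def)
qed

text \<open>By definition the series represents \<open>G\<close> only near infinity. The Taylor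
  series of a holomorphic function converges on the whole disc, which extends this to the region of
  stability.\<close>

lemma stable_system_sums:
  assumes G: "stable_system G g \<rho>" and \<rho>: "0 < \<rho>" "\<rho> < cmod z"
  shows "(\<lambda>k. complex_of_real (g k) * z powi (- int k)) sums G z"
proof -
  obtain F where F: "F holomorphic_on ball 0 (1 / \<rho>)" "\<And>w. w \<noteq> 0 \<Longrightarrow> F w = G (inverse w)"
    "\<And>k. (deriv ^^ k) F 0 / fact k = complex_of_real (g k)"
    using stable_system_disc[OF G \<rho>(1)] by blast
  have z: "z \<noteq> 0"
    using \<rho> by auto
  then have "inverse z \<in> ball 0 (1 / \<rho>)"
    using \<rho> frac_less2[of 1 1 \<rho> "cmod z"] by (simp add: norm_divide inverse_eq_divide)
  from holomorphic_power_series[OF F(1) this] show ?thesis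
    using z by (simp add: F(2) F(3) power_int_minus power_inverse)
qed

text \<open>This is Cauchy's inequality for the derivatives at 0 on the circle of radius
  \<open>1 / \<gamma>\<close> in the variable \<open>w\<close>. That circle corresponds to the
  circle of radius \<gamma> in \<open>z\<close>, over which the norm of the scaled system is
  taken.\<close>

lemma impulse_response_le:
  assumes G: "stable_system G g \<rho>" and \<rho>: "0 < \<rho>" and \<gamma>: "\<rho> < \<gamma>"
  shows "\<bar>g k\<bar> \<le> hinf_norm (\<lambda>z. G (complex_of_real \<gamma> * z)) * \<gamma> ^ k"
proof -
  define M where "M = hinf_norm (\<lambda>z. G (complex_of_real \<gamma> * z))"
  obtain F where F: "F holomorphic_on ball 0 (1 / \<rho>)" "\<And>w. w \<noteq> 0 \<Longrightarrow> F w = G (inverse w)"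
    "\<And>k. (deriv ^^ k) F 0 / fact k = complex_of_real (g k)"
    using stable_system_disc[OF G \<rho>] by blast
  have sub: "cball 0 (1 / \<gamma>) \<subseteq> ball (0::complex) (1 / \<rho>)"
    using \<rho> \<gamma> by (force simp: frac_less2 intro: le_less_trans[of _ "1 / \<gamma>"])
  have cont: "continuous_on (sphere 0 1) (\<lambda>z. G (complex_of_real \<gamma> * z))"
    using \<rho> \<gamma> by (intro continuous_on_compose2[OF stable_system_continuous_on[OF G subset_refl]]
        continuous_intros) (auto simp: norm_mult)
  have bound: "cmod (F x) \<le> M" if x: "cmod (0 - x) = 1 / \<gamma>" for x
  proof -
    have "x \<noteq> 0"
      using x \<rho> \<gamma> by auto
    moreover have "cmod (inverse x / complex_of_real \<gamma>) = 1"
      using x \<rho> \<gamma> by (simp add: norm_inverse norm_divide)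
    ultimately show ?thesis
      using cmod_le_hinf_norm[OF cont, of "inverse x / complex_of_real \<gamma>"] \<rho> \<gamma>
      by (simp add: M_def F(2))
  qed
  have "cmod ((deriv ^^ k) F 0) \<le> fact k * M / (1 / \<gamma>) ^ k"
  proof (rule Cauchy_inequality)
    show "F holomorphic_on ball 0 (1 / \<gamma>)"
      using F(1) sub ball_subset_cball holomorphic_on_subset by blast
    show "continuous_on (cball 0 (1 / \<gamma>)) F"
      using F(1) sub continuous_on_subset holomorphic_on_imp_continuous_on by blast
  qed (use \<rho> \<gamma> bound in auto)
  then have "cmod ((deriv ^^ k) F 0 / fact k) \<le> M * \<gamma> ^ k"
    by (simp add: norm_divide field_simps power_divide)
  then show ?thesis
    by (simp add: F(3) M_def)
qed

text \<open>On the unit circle the powers of \<open>z\<close> have modulus 1, so the coefficient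
  bounds from index \<open>r\<close> on sum to a geometric series.\<close>

lemma tail_le:
  assumes G: "stable_system G g \<rho>" and \<rho>: "0 < \<rho>" and \<gamma>: "\<rho> < \<gamma>" "\<gamma> < 1" and z: "cmod z = 1"
  shows "cmod (G z - (\<Sum>k<r. complex_of_real (g k) * z powi (- int k)))
           \<le> hinf_norm (\<lambda>z. G (complex_of_real \<gamma> * z)) * \<gamma> ^ r / (1 - \<gamma>)"
proof -
  define M where "M = hinf_norm (\<lambda>z. G (complex_of_real \<gamma> * z))"
  let ?f = "\<lambda>k. complex_of_real (g k) * z powi (- int k)"
  have "(\<lambda>k. ?f (k + r)) sums (G z - (\<Sum>k<r. ?f k))"
    using stable_system_sums[OF G \<rho>, of z] z \<gamma> by (intro sums_split_initial_segment) auto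
  moreover have "cmod (?f (k + r)) \<le> M * \<gamma> ^ r * \<gamma> ^ k" for k
    using impulse_response_le[OF G \<rho> \<gamma>(1), of "k + r"] z
    by (simp add: M_def norm_mult norm_power_int power_add mult_ac)
  moreover have "(\<lambda>k. M * \<gamma> ^ r * \<gamma> ^ k) sums (M * \<gamma> ^ r * (1 / (1 - \<gamma>)))"
    using \<rho> \<gamma> by (intro sums_mult geometric_sums) auto
  ultimately show ?thesis
    unfolding M_def[symmetric]
    using norm_suminf_le[of "\<lambda>k. ?f (k + r)" "\<lambda>k. M * \<gamma> ^ r * \<gamma> ^ k"]
    by (simp add: sums_iff)
qed

text \<open>Exponentiating the length condition bounds \<open>M / (1 - \<gamma>)\<close> by
  \<open>\<epsilon> * exp ((r + \<eta>) * (1 - \<gamma>))\<close>. Since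
  \<open>1 + x \<le> exp x\<close> gives
  \<open>\<gamma> ^ r \<le> exp (- (1 - \<gamma>) * r)\<close>, the terms in \<open>r\<close> cancel
  in the tail bound.\<close>

lemma truncation_error_le:
  assumes G: "stable_system G g \<rho>" and \<rho>: "0 < \<rho>" and z: "cmod z = 1" and \<epsilon>: "0 < \<epsilon>"
    and r: "sufficient_length G \<rho> \<epsilon> \<le> ereal (real r)"
  shows "cmod (G z - (\<Sum>k<r. complex_of_real (g k) * z powi (- int k))) \<le> \<epsilon>"
proof -
  define E where "E = cmod (G z - (\<Sum>k<r. complex_of_real (g k) * z powi (- int k)))"
  have "length_bound G \<rho> \<epsilon> \<le> sufficient_length G \<rho> \<epsilon>"
    unfolding sufficient_length_def by (rule INF_greatest) auto
  with r have lb: "length_bound G \<rho> \<epsilon> \<le> ereal (real r)"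
    by order
  \<comment> \<open>The infimum in \<^const>\<open>length_bound\<close> need not be attained, hence the slack \<open>\<eta>\<close>.\<close>
  have step: "E \<le> \<epsilon> * exp \<eta>" if \<eta>: "0 < \<eta>" for \<eta>
  proof -
    have "length_bound G \<rho> \<epsilon> < ereal (real r + \<eta>)"
      using lb by (rule le_less_trans) (use \<eta> in simp)
    then obtain \<gamma> where \<gamma>: "\<rho> < \<gamma>" "\<gamma> < 1" and lt: "ereal (1 / (1 - \<gamma>)) *
        ext_ln (hinf_norm (\<lambda>z. G (complex_of_real \<gamma> * z)) / (\<epsilon> * (1 - \<gamma>))) < ereal (real r + \<eta>)"
      unfolding length_bound_def INF_less_iff by auto
    define M where "M = hinf_norm (\<lambda>z. G (complex_of_real \<gamma> * z))"
    have EM: "E \<le> M * \<gamma> ^ r / (1 - \<gamma>)"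
      unfolding E_def M_def by (rule tail_le[OF G \<rho> \<gamma> z])
    have "0 \<le> M"
      using impulse_response_le[OF G \<rho> \<gamma>(1), of 0] by (simp add: M_def)
    \<comment> \<open>For \<open>M = 0\<close> the logarithm is minus infinity and carries no
      information, but the tail bound then forces \<open>E \<le> 0\<close>.\<close>
    then consider "M = 0" | "M > 0"
      by linarith
    then show ?thesis
    proof cases
      case 1
      then have "E \<le> 0"
        using EM by simp
      then show ?thesis
        using \<epsilon> by (smt (verit) exp_gt_zero mult_pos_pos)
    next
      case 2
      have pos: "0 < \<epsilon> * (1 - \<gamma>)"
        using \<epsilon> \<gamma> by simp
      have "1 / (1 - \<gamma>) * ln (M / (\<epsilon> * (1 - \<gamma>))) < real r + \<eta>"
        using lt 2 \<epsilon> \<gamma> by (simp add: ext_ln_def M_def)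
      then have "ln (M / (\<epsilon> * (1 - \<gamma>))) < (real r + \<eta>) * (1 - \<gamma>)"
        using \<gamma> by (simp add: field_simps)
      then have "M / (\<epsilon> * (1 - \<gamma>)) < exp ((real r + \<eta>) * (1 - \<gamma>))"
        using 2 pos by (metis divide_pos_pos exp_less_cancel_iff exp_ln)
      then have "M / (1 - \<gamma>) \<le> \<epsilon> * exp ((real r + \<eta>) * (1 - \<gamma>))"
        using \<epsilon> \<gamma> by (simp add: field_simps)
      moreover have "\<gamma> ^ r \<le> exp (- (1 - \<gamma>) * real r)"
      proof -
        have "\<gamma> \<le> exp (\<gamma> - 1)"
          using exp_ge_add_one_self[of "\<gamma> - 1"] by simp
        then have "\<gamma> ^ r \<le> exp (\<gamma> - 1) ^ r"
          using \<rho> \<gamma> by (intro power_mono) auto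
        then show ?thesis
          by (simp add: exp_of_nat_mult[symmetric] mult.commute)
      qed
      ultimately have "M / (1 - \<gamma>) * \<gamma> ^ r
          \<le> \<epsilon> * exp ((real r + \<eta>) * (1 - \<gamma>)) * exp (- (1 - \<gamma>) * real r)"
        using \<rho> \<gamma> \<epsilon> by (intro mult_mono) auto
      also have "\<dots> = \<epsilon> * exp (\<eta> * (1 - \<gamma>))"
        by (simp add: mult_exp_exp algebra_simps)
      also have "\<dots> \<le> \<epsilon> * exp \<eta>"
        using \<epsilon> \<eta> \<rho> \<gamma> by (simp add: mult_left_le)
      finally show ?thesis
        using EM by simp
    qed
  qed
  \<comment> \<open>The slack is removed by letting \<eta> tend to 0 from the right.\<close>
  have "((\<lambda>\<eta>. \<epsilon> * exp \<eta>) \<longlongrightarrow> \<epsilon> * exp 0) (at_right 0)"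
    by (intro tendsto_intros)
  moreover have "eventually (\<lambda>\<eta>. E \<le> \<epsilon> * exp \<eta>) (at_right (0::real))"
    using step by (auto simp: eventually_at_right_less eventually_at intro!: exI[of _ 1])
  ultimately have "E \<le> \<epsilon> * exp 0"
    by (intro tendsto_lowerbound) auto
  then show ?thesis
    by (simp add: E_def)
qed

section \<open>Least squares for harmonic inputs\<close>

text \<open>Row \<open>p\<close> of the stacked system is time \<open>p mod T\<close> of measurement
  \<open>p div T\<close>. This passes between the stacked index and such pairs.\<close>

lemma sum_lessThan_mult:
  fixes f :: "nat \<Rightarrow> nat \<Rightarrow> 'a::comm_monoid_add"
  shows "(\<Sum>p<T * m. f (p div T) (p mod T)) = (\<Sum>a<m. \<Sum>t<T. f a t)"
proof -
  have "(\<Sum>p<T * m. f (p div T) (p mod T)) = (\<Sum>a<m. \<Sum>p\<in>{a * T..<a * T + T}. f (p div T) (p mod T))"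
    by (simp add: sum.nat_group mult.commute)
  also have "\<dots> = (\<Sum>a<m. \<Sum>t<T. f a t)"
  proof (rule sum.cong[OF refl])
    fix a
    have "(\<Sum>p\<in>{a * T..<a * T + T}. f (p div T) (p mod T))
        = (\<Sum>t\<in>{0..<T}. f ((t + a * T) div T) ((t + a * T) mod T))"
      using sum.shift_bounds_nat_ivl[of "\<lambda>p. f (p div T) (p mod T)" 0 "a * T" T]
      by (simp add: add.commute)
    then show "(\<Sum>p\<in>{a * T..<a * T + T}. f (p div T) (p mod T)) = (\<Sum>t<T. f a t)"
      by (simp add: atLeast0LessThan)
  qed
  finally show ?thesis .
qed

text \<open>For orthogonal columns the Gram matrix is diagonal and its inverse explicit, so each
  coordinate of the estimate is the projection onto one column.\<close>

lemma least_squares_orthogonal_columns: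
  assumes Z: "Z \<in> carrier_mat N T" and Y: "Y \<in> carrier_vec N"
    and ortho: "\<And>j k. j < T \<Longrightarrow> k < T \<Longrightarrow>
      (\<Sum>p<N. Z $$ (p, j) * Z $$ (p, k)) = (if j = k then d j else 0)"
    and d: "\<And>j. j < T \<Longrightarrow> d j \<noteq> 0" and j: "j < T"
  shows "least_squares Z Y $ j = (\<Sum>p<N. Z $$ (p, j) * Y $ p) / d j"
proof -
  define A where "A = transpose_mat Z * Z"
  define D where "D = mat T T (\<lambda>(i, j). if i = j then 1 / d j else 0)"
  have A: "A \<in> carrier_mat T T" and D: "D \<in> carrier_mat T T"
    using Z by (auto simp: A_def D_def)
  have A_eq: "A $$ (i, k) = (if i = k then d i else 0)" if "i < T" "k < T" for i k
    using ortho[OF that] that Z by (simp add: A_def scalar_prod_def atLeast0LessThan)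
  have AD: "A * D = 1\<^sub>m T"
  proof (rule eq_matI)
    fix i k assume ik: "i < dim_row (1\<^sub>m T :: real mat)" "k < dim_col (1\<^sub>m T :: real mat)"
    have "(A * D) $$ (i, k) = (\<Sum>l<T. A $$ (i, l) * D $$ (l, k))"
      using ik A D by (simp add: scalar_prod_def atLeast0LessThan)
    also have "\<dots> = (\<Sum>l<T. if i = l then d i * D $$ (l, k) else 0)"
      using ik by (intro sum.cong) (auto simp: A_eq)
    also have "\<dots> = 1\<^sub>m T $$ (i, k)"
      using ik by (auto simp: sum.delta D_def d)
    finally show "(A * D) $$ (i, k) = 1\<^sub>m T $$ (i, k)" .
  qed (use A D in auto)
  \<comment> \<open>\<open>mat_inverse\<close> returns an option; invertibility excludes
    \<open>None\<close>, and uniqueness of inverses then identifies the result with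
    \<open>D\<close>.\<close>
  have "A \<in> Units (ring_mat TYPE(real) T ())"
    using AD mat_mult_left_right_inverse[OF A D AD] A D
    by (auto simp: Units_def ring_mat_simps)
  then obtain B where inv: "mat_inverse A = Some B"
    using mat_inverse(1)[OF A, where b = "()"] by blast
  have B: "B * A = 1\<^sub>m T" "B \<in> carrier_mat T T"
    using mat_inverse(2)[OF A inv] by auto
  have "B = B * (A * D)"
    using B AD by simp
  also have "\<dots> = D"
    using assoc_mult_mat[OF B(2) A D] B D by simp
  finally have "least_squares Z Y = D *\<^sub>v (transpose_mat Z *\<^sub>v Y)"
    using Z Y D inv assoc_mult_mat_vec[of D T T "transpose_mat Z" N Y]
    by (simp add: least_squares_def A_def)
  then have "least_squares Z Y $ j
      = (\<Sum>l<T. (if j = l then 1 / d l else 0) * (\<Sum>p<N. Z $$ (p, l) * Y $ p))"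
    using j Z Y D by (simp add: scalar_prod_def atLeast0LessThan D_def)
  also have "\<dots> = (\<Sum>l<T. if j = l then (\<Sum>p<N. Z $$ (p, l) * Y $ p) / d l else 0)"
    by (intro sum.cong) auto
  finally show ?thesis
    using j by simp
qed

text \<open>The sum is the real part of a geometric series in the root of unity \<open>x\<close>,
  and \<open>x = 1\<close> would force \<open>n\<close> to divide \<open>d\<close>.\<close>

lemma sum_cos_roots_of_unity:
  assumes "\<bar>d\<bar> < int n"
  shows "(\<Sum>i<n. cos (2 * pi * real i * real_of_int d / real n)) = (if d = 0 then real n else 0)"
proof (cases "d = 0")
  case False
  define x where "x = cis (2 * pi * real_of_int d / real n)"
  have n: "n > 0"
    using assms by linarith
  have "x \<noteq> 1"
  proof
    assume "x = 1"
    then have "cos (2 * pi * real_of_int d / real n) = 1"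
      by (metis x_def cis.sel(1) one_complex.sel(1))
    then obtain k :: int where "2 * pi * real_of_int d / real n = of_int k * 2 * pi"
      by (auto simp: cos_one_2pi_int)
    then have "real_of_int d = real_of_int (k * int n)"
      using n by (simp add: field_simps)
    then have "d = k * int n"
      by (simp only: of_int_eq_iff)
    then have "int n dvd d"
      by simp
    then show False
      using assms False zdvd_imp_le[of "int n" "\<bar>d\<bar>"] by simp
  qed
  moreover have "x ^ n = 1"
  proof -
    have "real n * (2 * pi * real_of_int d / real n) = 2 * pi * real_of_int d"
      using n by simp
    then have "x ^ n = cis (2 * pi * real_of_int d)"
      unfolding x_def Complex.DeMoivre by (rule arg_cong)
    then show ?thesis
      using cis_multiple_2pi[of "real_of_int d"] by (simp only: Ints_of_int)
  qed
  ultimately have "(\<Sum>i<n. x ^ i) = 0"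
    by (simp add: geometric_sum)
  then have "Re (\<Sum>i<n. x ^ i) = 0"
    by simp
  then show ?thesis
    using False by (simp add: x_def Complex.DeMoivre mult_ac)
qed auto

section \<open>Orthogonality and Gram matrix of the harmonic inputs\<close>

lemma harmonic_inputs_subset: "set (harmonic_inputs n T) \<subseteq> linf_ball T"
  by (auto simp: harmonic_inputs_def linf_ball_def cos_input_def sin_input_def)

lemma length_harmonic_inputs: "length (harmonic_inputs n T) = 2 * n"
  by (simp add: harmonic_inputs_def)

lemma sum_harmonic_inputs:
  "(\<Sum>a<2 * n. f (harmonic_inputs n T ! a)) = (\<Sum>i<n. f (cos_input n T i) + f (sin_input n T i))"
  for f :: "real vec \<Rightarrow> real"
proof -
  have "(\<Sum>a<2 * n. f (harmonic_inputs n T ! a)) = sum_list (map f (harmonic_inputs n T))"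
    by (simp add: sum_list_sum_nth length_harmonic_inputs atLeast0LessThan)
  also have "\<dots> = (\<Sum>i<n. f (cos_input n T i)) + (\<Sum>i<n. f (sin_input n T i))"
    by (simp add: harmonic_inputs_def o_def interv_sum_list_conv_sum_set_nat atLeast0LessThan)
  finally show ?thesis
    by (simp add: sum.distrib)
qed

text \<open>Adding the cosine and sine contributions gives the cosine of the difference of the
  angles, so the previous sum applies with \<open>d = s - t\<close>. The condition
  \<open>T \<le> n\<close> ensures \<open>\<bar>d\<bar> < n\<close>.\<close>

lemma harmonic_inputs_orthogonal:
  assumes "s < T" "t < T" "T \<le> n"
  shows "(\<Sum>a<2 * n. harmonic_inputs n T ! a $ s * harmonic_inputs n T ! a $ t)
           = (if s = t then real n else 0)"
proof -
  have "(\<Sum>a<2 * n. harmonic_inputs n T ! a $ s * harmonic_inputs n T ! a $ t)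
      = (\<Sum>i<n. cos (2 * pi * real i * real_of_int (int s - int t) / real n))"
    using assms by (simp add: sum_harmonic_inputs[of "\<lambda>u. u $ s * u $ t"] cos_input_def
        sin_input_def right_diff_distrib diff_divide_distrib cos_diff)
  then show ?thesis
    using assms sum_cos_roots_of_unity[of "int s - int t" n] by auto
qed

text \<open>For fixed time \<open>t\<close>, summing over the inputs first pairs entry
  \<open>t - j\<close> with entry \<open>t - k\<close>. By orthogonality only \<open>j = k\<close>
  survives, and column \<open>j\<close> is supported on the \<open>T - j\<close> times
  \<open>t \<ge> j\<close>.\<close>

lemma Gram_harmonic_inputs:
  assumes T: "T \<le> n" and jk: "j < T" "k < T"
  defines "Z \<equiv> stacked_Toep T (harmonic_inputs n T)"
  shows "(\<Sum>p<T * (2 * n). Z $$ (p, j) * Z $$ (p, k)) = (if j = k then real n * real (T - j) else 0)"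
proof -
  define u where "u = (\<lambda>a t. harmonic_inputs n T ! a $ t)"
  define h where "h = (\<lambda>a t j. if j \<le> t then u a (t - j) else 0)"
  have "(\<Sum>p<T * (2 * n). Z $$ (p, j) * Z $$ (p, k))
      = (\<Sum>p<T * (2 * n). h (p div T) (p mod T) j * h (p div T) (p mod T) k)"
    using jk by (intro sum.cong) (auto simp: Z_def stacked_Toep_def Toep_def h_def u_def
        length_harmonic_inputs)
  also have "\<dots> = (\<Sum>t<T. \<Sum>a<2 * n. h a t j * h a t k)"
    by (subst sum_lessThan_mult[of "\<lambda>a t. h a t j * h a t k"]) (rule sum.swap)
  also have "\<dots> = (\<Sum>t<T. if j = k \<and> j \<le> t then real n else 0)"
  proof (rule sum.cong[OF refl])
    fix t assume t: "t \<in> {..<T}"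
    show "(\<Sum>a<2 * n. h a t j * h a t k) = (if j = k \<and> j \<le> t then real n else 0)"
    proof (cases "j \<le> t \<and> k \<le> t")
      case True
      then have "(\<Sum>a<2 * n. h a t j * h a t k) = (\<Sum>a<2 * n. u a (t - j) * u a (t - k))"
        by (simp add: h_def)
      also have "\<dots> = (if t - j = t - k then real n else 0)"
        unfolding u_def using t T by (intro harmonic_inputs_orthogonal) auto
      finally show ?thesis
        using True by auto
    next
      case False
      then show ?thesis
        by (auto simp: h_def)
    qed
  qed
  also have "\<dots> = (if j = k then real n * real (T - j) else 0)"
  proof -
    have "{..<T} \<inter> {t. j \<le> t} = {j..<T}"
      by auto
    then have "(\<Sum>t<T. if j \<le> t then real n else 0) = real n * real (T - j)"
      by (simp add: sum.If_cases)
    then show ?thesis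
      by (cases "j = k") auto
  qed
  finally show ?thesis .
qed

text \<open>By causality the first \<open>T\<close> outputs involve only the first \<open>T\<close>
  coefficients of \<open>g\<close>. The linear model is therefore exact: the infinite tail of the
  system causes no bias.\<close>

lemma stacked_measurements_nth:
  assumes "p < T * length us"
  shows "stacked_measurements g T us \<omega> $ p
           = (\<Sum>k<T. stacked_Toep T us $$ (p, k) * g k) + \<omega> (p div T) (p mod T)"
proof -
  have T: "p mod T < T"
    using assms by (cases T) auto
  have "(\<Sum>k\<le>p mod T. g k * us ! (p div T) $ (p mod T - k))
      = (\<Sum>k<T. if k \<le> p mod T then us ! (p div T) $ (p mod T - k) * g k else 0)"
    using T by (intro sum.mono_neutral_cong_left) auto
  also have "\<dots> = (\<Sum>k<T. stacked_Toep T us $$ (p, k) * g k)"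
    using assms T by (intro sum.cong) (auto simp: stacked_Toep_def Toep_def)
  finally show ?thesis
    using assms T by (simp add: stacked_measurements_def measurement_def)
qed

lemma least_squares_harmonic_inputs:
  assumes T: "T \<le> n" and j: "j < T"
  defines "Z \<equiv> stacked_Toep T (harmonic_inputs n T)"
  shows "least_squares Z (stacked_measurements g T (harmonic_inputs n T) \<omega>) $ j
    = g j + (\<Sum>p<T * (2 * n). Z $$ (p, j) * \<omega> (p div T) (p mod T)) / (real n * real (T - j))"
proof -
  define N where "N = T * (2 * n)"
  define Y where "Y = stacked_measurements g T (harmonic_inputs n T) \<omega>"
  have gram: "(\<Sum>p<N. Z $$ (p, i) * Z $$ (p, k)) = (if i = k then real n * real (T - i) else 0)"
    if "i < T" "k < T" for i k
    unfolding N_def Z_def using Gram_harmonic_inputs[OF T that] .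
  have "(\<Sum>p<N. Z $$ (p, j) * Y $ p)
      = (\<Sum>p<N. (\<Sum>k<T. Z $$ (p, j) * Z $$ (p, k) * g k) + Z $$ (p, j) * \<omega> (p div T) (p mod T))"
    by (intro sum.cong refl)
      (simp add: Y_def Z_def N_def stacked_measurements_nth length_harmonic_inputs
        distrib_left sum_distrib_left mult.assoc)
  also have "\<dots> = (\<Sum>k<T. (\<Sum>p<N. Z $$ (p, j) * Z $$ (p, k)) * g k)
      + (\<Sum>p<N. Z $$ (p, j) * \<omega> (p div T) (p mod T))"
    by (simp add: sum.distrib sum_distrib_right) (rule sum.swap)
  also have "(\<Sum>k<T. (\<Sum>p<N. Z $$ (p, j) * Z $$ (p, k)) * g k)
      = (\<Sum>k<T. if j = k then real n * real (T - j) * g j else 0)"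
    using j by (intro sum.cong) (auto simp: gram)
  also have "\<dots> = real n * real (T - j) * g j"
    using j by simp
  finally have ZY: "(\<Sum>p<N. Z $$ (p, j) * Y $ p)
      = real n * real (T - j) * g j + (\<Sum>p<N. Z $$ (p, j) * \<omega> (p div T) (p mod T))" .
  have "least_squares Z Y $ j = (\<Sum>p<N. Z $$ (p, j) * Y $ p) / (real n * real (T - j))"
  proof (rule least_squares_orthogonal_columns[OF _ _ gram])
    show "Z \<in> carrier_mat N T" "Y \<in> carrier_vec N"
      by (auto simp: Z_def Y_def N_def stacked_Toep_def stacked_measurements_def
          length_harmonic_inputs)
  qed (use T j in auto)
  then show ?thesis
    using T j unfolding ZY by (simp add: Y_def N_def add_divide_distrib)
qed

section \<open>Gaussian linear forms\<close>

abbreviation centered_normal :: "real \<Rightarrow> real measure" where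
  "centered_normal \<sigma> \<equiv> density lborel (\<lambda>x. ennreal (normal_density 0 \<sigma> x))"

lemma centered_normal_eq_distr:
  assumes "\<sigma> > 0"
  shows "centered_normal \<sigma> = distr std_normal_distribution borel (\<lambda>x. \<sigma> * x)"
proof -
  interpret prob_space std_normal_distribution
    by (rule prob_space_normal_density) simp
  have "distributed std_normal_distribution lborel (\<lambda>x. x) std_normal_density"
    by (auto simp: distributed_def distr_id2)
  from normal_density_affine[OF this, of \<sigma> 0]
  have "distributed std_normal_distribution lborel (\<lambda>x. \<sigma> * x) (normal_density 0 \<sigma>)"
    using assms by simp
  then show ?thesis
    by (simp add: distributed_def cong: distr_cong)
qed

lemma integral_exp_centered_normal:
  assumes "\<sigma> > 0"
  shows "(LINT x|centered_normal \<sigma>. exp (\<i> * complex_of_real (t * x)))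
           = complex_of_real (exp (- (\<sigma> * t)\<^sup>2 / 2))"
proof -
  have "(LINT x|centered_normal \<sigma>. exp (\<i> * complex_of_real (t * x))) =
      char std_normal_distribution (t * \<sigma>)"
    unfolding centered_normal_eq_distr[OF assms] char_def
    by (subst integral_distr) (auto simp: mult_ac)
  then show ?thesis
    by (simp add: char_std_normal_distribution mult.commute)
qed

text \<open>The exponential turns the sum into a product, which Fubini integrates factorwise.
  General functions \<open>f i\<close> are allowed because the lemma serves on two levels: over
  measurements, whose coordinates are whole noise vectors, and over times.\<close>

lemma integral_exp_linear_PiM:
  fixes I :: "'i set" and f :: "'i \<Rightarrow> 'a \<Rightarrow> real"
  assumes M: "\<And>i. prob_space (M i)" and I: "finite I"
    and f: "\<And>i. i \<in> I \<Longrightarrow> f i \<in> borel_measurable (M i)"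
  shows "(LINT \<omega>|PiM I M. exp (\<i> * complex_of_real (\<Sum>i\<in>I. f i (\<omega> i))))
           = (\<Prod>i\<in>I. LINT x|M i. exp (\<i> * complex_of_real (f i x)))"
proof -
  interpret prob_space "M i" for i
    by (rule M)
  interpret product_prob_space M I ..
  have "integrable (M i) (\<lambda>x. exp (\<i> * complex_of_real (f i x)))" if "i \<in> I" for i
    using f[OF that] by (intro finite_measure.integrable_const_bound[OF prob_space.finite_measure[OF M], where B = 1]) auto
  from product_integral_prod[OF I this] show ?thesis
    using I by (simp add: sum_distrib_left exp_sum)
qed

section \<open>Law and tails of linear forms in the noise\<close>

lemma prob_space_gaussian_noise:
  assumes "\<sigma> > 0"
  shows "prob_space (gaussian_noise T \<sigma>)" "prob_space (noise_law m T \<sigma>)"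
proof -
  show *: "prob_space (gaussian_noise T \<sigma>)"
    unfolding gaussian_noise_def by (intro prob_space_PiM prob_space_normal_density assms)
  show "prob_space (noise_law m T \<sigma>)"
    unfolding noise_law_def by (intro prob_space_PiM *)
qed

lemma gaussian_noise_component_measurable:
  "(\<lambda>x. x t) \<in> borel_measurable (gaussian_noise T \<sigma>)" if "t < T"
  using measurable_component_singleton[of t "{..<T}" "\<lambda>_. centered_normal \<sigma>"] that
  by (simp add: gaussian_noise_def)

lemma noise_law_component_measurable:
  assumes "a < m" "t < T"
  shows "(\<lambda>\<omega>. \<omega> a t) \<in> borel_measurable (noise_law m T \<sigma>)"
proof -
  have "(\<lambda>\<omega>. \<omega> a) \<in> measurable (noise_law m T \<sigma>) (gaussian_noise T \<sigma>)"
    unfolding noise_law_def using assms by (intro measurable_component_singleton) auto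
  from measurable_compose[OF this gaussian_noise_component_measurable] show ?thesis
    using assms by simp
qed

lemma linear_form_measurable:
  "(\<lambda>\<omega>. \<Sum>a<m. \<Sum>t<T. w a t * \<omega> a t) \<in> borel_measurable (noise_law m T \<sigma>)"
  by (intro borel_measurable_sum borel_measurable_times borel_measurable_const
      noise_law_component_measurable) auto

text \<open>Independence factors the characteristic function over measurements and times. The
  exponents add up to that of a single normal law, and Levy's uniqueness theorem concludes.\<close>

lemma distr_linear_form_noise:
  assumes \<sigma>: "\<sigma> > 0" and s: "s > 0" and s2: "s\<^sup>2 = \<sigma>\<^sup>2 * (\<Sum>a<m. \<Sum>t<T. (w a t)\<^sup>2)"
  shows "distr (noise_law m T \<sigma>) borel (\<lambda>\<omega>. \<Sum>a<m. \<Sum>t<T. w a t * \<omega> a t) = centered_normal s"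
proof (rule Levy_uniqueness)
  let ?X = "\<lambda>\<omega>. \<Sum>a<m. \<Sum>t<T. w a t * \<omega> a t"
  note X = linear_form_measurable[where m = m and T = T and w = w and \<sigma> = \<sigma>]
  interpret prob_space "noise_law m T \<sigma>"
    by (rule prob_space_gaussian_noise[OF \<sigma>])
  show "real_distribution (distr (noise_law m T \<sigma>) borel ?X)"
    using X by (intro real_distribution_distr)
  show "real_distribution (centered_normal s)"
    using prob_space_normal_density[OF s]
    by (auto simp: real_distribution_def real_distribution_axioms_def)
  show "char (distr (noise_law m T \<sigma>) borel ?X) = char (centered_normal s)"
  proof
    fix t
    have "char (distr (noise_law m T \<sigma>) borel ?X) t
        = (LINT \<omega>|noise_law m T \<sigma>. exp (\<i> * complex_of_real (\<Sum>a<m. \<Sum>k<T. t * w a k * \<omega> a k)))"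
      unfolding char_def using X
      by (subst integral_distr) (auto simp: sum_distrib_left mult_ac)
    also have "\<dots> = (\<Prod>a<m. LINT x|gaussian_noise T \<sigma>.
        exp (\<i> * complex_of_real (\<Sum>k<T. t * w a k * x k)))"
      unfolding noise_law_def
      by (rule integral_exp_linear_PiM) (auto intro!: prob_space_gaussian_noise[OF \<sigma>]
          borel_measurable_sum borel_measurable_times gaussian_noise_component_measurable)
    also have "\<dots> = (\<Prod>a<m. \<Prod>k<T. LINT x|centered_normal \<sigma>.
        exp (\<i> * complex_of_real (t * w a k * x)))"
      unfolding gaussian_noise_def
      by (intro prod.cong refl integral_exp_linear_PiM prob_space_normal_density[OF \<sigma>]) auto
    also have "\<dots> = complex_of_real (exp (- (\<Sum>a<m. \<Sum>k<T. (\<sigma> * (t * w a k))\<^sup>2) / 2))"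
      unfolding integral_exp_centered_normal[OF \<sigma>]
      by (simp add: exp_sum[symmetric] of_real_prod[symmetric] sum_negf sum_divide_distrib
          del: of_real_prod of_real_exp)
    also have "(\<Sum>a<m. \<Sum>k<T. (\<sigma> * (t * w a k))\<^sup>2) = (s * t)\<^sup>2"
      by (simp add: power_mult_distrib s2 sum_distrib_left mult_ac)
    also have "complex_of_real (exp (- (s * t)\<^sup>2 / 2)) = char (centered_normal s) t"
      using integral_exp_centered_normal[OF s, of t] by (simp add: char_def)
    finally show "char (distr (noise_law m T \<sigma>) borel ?X) t = char (centered_normal s) t" .
  qed
qed

text \<open>
  Chernoff's bound would have an additional factor 2. That factor is not affordable for \<open>r = 1\<close>:
  then \<open>ln r = 0\<close>, and for \<open>\<delta>\<close> close to 1 the required number of measurements is so small that the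
  failure probability itself is close to 1.
\<close>

lemma measure_centered_normal_tail:
  assumes s: "s > 0" and x: "x \<ge> 0"
  shows "measure (centered_normal s) {y. \<bar>y\<bar> > x} \<le> exp (- x\<^sup>2 / (2 * s\<^sup>2))"
proof -
  define \<phi> where "\<phi> = normal_density 0 s"
  define e where "e = exp (- x\<^sup>2 / (2 * s\<^sup>2))"
  have \<phi>[measurable]: "\<phi> \<in> borel_measurable borel" and \<phi>_nn: "\<And>y. 0 \<le> \<phi> y"
    by (auto simp: \<phi>_def)
  interpret prob_space "centered_normal s"
    by (rule prob_space_normal_density[OF s])
  \<comment> \<open>For nonnegative \<open>x\<close> and \<open>y\<close>, \<open>(x + y)^2\<close>
    is at least \<open>x^2 + y^2\<close>, so the shifted density is at most \<open>e\<close> times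
    the original one.\<close>
  have shift: "\<phi> (x + y) \<le> e * \<phi> y" if "y \<ge> 0" for y
  proof -
    have "- (x + y)\<^sup>2 / (2 * s\<^sup>2) \<le> - x\<^sup>2 / (2 * s\<^sup>2) + - y\<^sup>2 / (2 * s\<^sup>2)"
      using x s that by (simp add: power2_sum field_simps)
    then have "exp (- (x + y)\<^sup>2 / (2 * s\<^sup>2)) \<le> e * exp (- y\<^sup>2 / (2 * s\<^sup>2))"
      by (simp add: e_def mult_exp_exp)
    then show ?thesis
      by (simp add: \<phi>_def normal_density_def divide_right_mono)
  qed
  have even: "\<phi> (- y) = \<phi> y" for y
    by (simp add: \<phi>_def normal_density_def)
  have half: "(\<integral>\<^sup>+y. ennreal (\<phi> y) * indicator {..< - c} y \<partial>lborel)
      = (\<integral>\<^sup>+y. ennreal (\<phi> y) * indicator {c<..} y \<partial>lborel)" for c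
    by (subst nn_integral_real_affine[where c = "-1" and t = 0])
      (auto simp: even intro!: nn_integral_cong split: split_indicator)
  \<comment> \<open>Used with \<open>c = x\<close> and with \<open>c = 0\<close>. In the second case
    the left side is at most 1, which yields the tail bound with leading constant 1.\<close>
  have both: "emeasure (centered_normal s) {y. \<bar>y\<bar> > c}
      = 2 * (\<integral>\<^sup>+y. ennreal (\<phi> y) * indicator {c<..} y \<partial>lborel)" if "c \<ge> 0" for c
  proof -
    have "emeasure (centered_normal s) {y. \<bar>y\<bar> > c}
        = (\<integral>\<^sup>+y. ennreal (\<phi> y) * indicator {..< - c} y + ennreal (\<phi> y) * indicator {c<..} y \<partial>lborel)"
      using that unfolding \<phi>_def
      by (subst emeasure_density) (auto intro!: nn_integral_cong split: split_indicator)
    also have "\<dots> = (\<integral>\<^sup>+y. ennreal (\<phi> y) * indicator {..< - c} y \<partial>lborel)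
        + (\<integral>\<^sup>+y. ennreal (\<phi> y) * indicator {c<..} y \<partial>lborel)"
      by (intro nn_integral_add) auto
    finally show ?thesis
      by (simp add: half mult_2)
  qed
  have "(\<integral>\<^sup>+y. ennreal (\<phi> y) * indicator {x<..} y \<partial>lborel)
      = (\<integral>\<^sup>+y. ennreal (\<phi> (x + y)) * indicator {0<..} y \<partial>lborel)"
    by (subst nn_integral_real_affine[where c = 1 and t = x])
      (auto intro!: nn_integral_cong split: split_indicator)
  also have "\<dots> \<le> (\<integral>\<^sup>+y. ennreal e * (ennreal (\<phi> y) * indicator {0<..} y) \<partial>lborel)"
    using shift \<phi>_nn
    by (intro nn_integral_mono) (auto simp: ennreal_mult[symmetric] e_def split: split_indicator)
  also have "\<dots> = ennreal e * (\<integral>\<^sup>+y. ennreal (\<phi> y) * indicator {0<..} y \<partial>lborel)"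
    by (intro nn_integral_cmult) auto
  finally have "emeasure (centered_normal s) {y. \<bar>y\<bar> > x}
      \<le> ennreal e * emeasure (centered_normal s) {y. \<bar>y\<bar> > 0}"
    unfolding both[OF x] both[OF order_refl] by (subst mult.left_commute) (rule mult_left_mono, auto)
  also have "\<dots> \<le> ennreal e * 1"
    by (intro mult_left_mono emeasure_le_1) auto
  finally show ?thesis
    by (simp add: emeasure_eq_measure e_def)
qed

lemma linear_form_noise_tail:
  assumes \<sigma>: "\<sigma> > 0" and x: "x \<ge> 0" and v: "v > 0"
    and le: "\<sigma>\<^sup>2 * (\<Sum>a<m. \<Sum>t<T. (w a t)\<^sup>2) \<le> v"
  shows "measure (noise_law m T \<sigma>)
      {\<omega> \<in> space (noise_law m T \<sigma>). \<bar>\<Sum>a<m. \<Sum>t<T. w a t * \<omega> a t\<bar> > x} \<le> exp (- x\<^sup>2 / (2 * v))"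
proof -
  let ?X = "\<lambda>\<omega>. \<Sum>a<m. \<Sum>t<T. w a t * \<omega> a t"
  define S where "S = \<sigma>\<^sup>2 * (\<Sum>a<m. \<Sum>t<T. (w a t)\<^sup>2)"
  have "S \<ge> 0"
    by (simp add: S_def sum_nonneg)
  then consider "S = 0" | "S > 0"
    by linarith
  \<comment> \<open>If the variance \<open>S\<close> vanishes there is no normal density to compare
    with, but all weights are then zero and the event is empty.\<close>
  then show ?thesis
  proof cases
    case 1
    then have "(\<Sum>a<m. \<Sum>t<T. (w a t)\<^sup>2) = 0"
      using \<sigma> by (simp add: S_def)
    then have "w a t = 0" if "a < m" "t < T" for a t
      using that by (auto simp: sum_nonneg_eq_0_iff sum_nonneg)
    then have "{\<omega> \<in> space (noise_law m T \<sigma>). \<bar>?X \<omega>\<bar> > x} = {}"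
      using x by simp
    then show ?thesis
      by (simp only: measure_empty exp_ge_zero)
  next
    case 2
    have "measure (noise_law m T \<sigma>) {\<omega> \<in> space (noise_law m T \<sigma>). \<bar>?X \<omega>\<bar> > x}
        = measure (distr (noise_law m T \<sigma>) borel ?X) {y. \<bar>y\<bar> > x}"
      by (subst measure_distr[OF linear_form_measurable])
        (auto intro!: arg_cong[where f = "measure (noise_law m T \<sigma>)"])
    also have "distr (noise_law m T \<sigma>) borel ?X = centered_normal (sqrt S)"
      using 2 by (intro distr_linear_form_noise[OF \<sigma>]) (auto simp: S_def)
    also have "measure \<dots> {y. \<bar>y\<bar> > x} \<le> exp (- x\<^sup>2 / (2 * S))"
      using measure_centered_normal_tail[of "sqrt S" x] 2 x by simp
    also have "\<dots> \<le> exp (- x\<^sup>2 / (2 * v))"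
      using 2 le by (simp add: S_def[symmetric] divide_left_mono)
    finally show ?thesis .
  qed
qed

section \<open>Uniform error\<close>

text \<open>A chord is no longer than its arc.\<close>

lemma cmod_cis_diff_le: "cmod (cis a - cis b) \<le> \<bar>a - b\<bar>"
proof -
  have "cis a - cis b = cis b * (cis (a - b) - 1)"
    by (simp add: algebra_simps cis_mult)
  then have "cmod (cis a - cis b) = cmod (iexp (a - b) - 1)"
    by (simp add: norm_mult cis_conv_exp)
  then show ?thesis
    using iexp_approx1[of "a - b" 0] by simp
qed

text \<open>
  The uniform norm on the circle is replaced by finitely many linear forms in the coefficients:
  the values on a grid, and the coefficients themselves, which control the derivative between grid
  points. The bound on the cardinality gives a single form for \<open>r = 1\<close>, so that the union bound
  is lossless there.
\<close>

lemma norming_family: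
  assumes "r \<ge> 1"
  obtains F :: "(nat \<Rightarrow> real) set" where "finite F" "card F \<le> r ^ 4"
    "\<And>c j. c \<in> F \<Longrightarrow> \<bar>c j\<bar> \<le> 1"
    "\<And>e z b. cmod z = 1 \<Longrightarrow> (\<And>c. c \<in> F \<Longrightarrow> \<bar>\<Sum>j<r. c j * e j\<bar> \<le> b) \<Longrightarrow>
       cmod (\<Sum>j<r. complex_of_real (e j) * z powi (- int j)) \<le> 9 * b"
proof (cases "r = 1")
  case True
  show ?thesis
    by (rule that[of "{\<lambda>_. 1}"]) (use True in \<open>auto simp: lessThan_Suc\<close>)
next
  case False
  \<comment> \<open>If all coefficients are at most \<open>b\<close> in modulus, the derivative of
    \<open>P\<close> is at most \<open>r^2 * b\<close>. With \<open>r^2\<close> grid points the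
    variation between neighbours is thus at most \<open>2 * pi * b\<close>, independent of
    \<open>r\<close>.\<close>
  define N where "N = r\<^sup>2"
  define \<theta> where "\<theta> = (\<lambda>l. 2 * pi * real l / real N)"
  define A B C where "A = (\<lambda>l j. cos (real j * \<theta> l)) ` {..<N}"
    and "B = (\<lambda>l j. sin (real j * \<theta> l)) ` {..<N}"
    and "C = (\<lambda>i j. if i = j then 1 else 0 :: real) ` {..<r}"
  have r: "r \<ge> 2"
    using assms False by simp
  then have N: "N > 0"
    by (simp add: N_def)
  show ?thesis
  proof (rule that[of "A \<union> B \<union> C"])
    show "finite (A \<union> B \<union> C)"
      by (simp add: A_def B_def C_def)
    have "card (A \<union> B \<union> C) \<le> card A + card B + card C"
      by (meson add_mono card_Un_le le_trans order_refl)
    also have "\<dots> \<le> N + N + r"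
      unfolding A_def B_def C_def
      by (intro add_mono order.trans[OF card_image_le]) auto
    also have "\<dots> \<le> r\<^sup>2 * 4"
      using r by (simp add: N_def power2_eq_square)
    \<comment> \<open>Here \<open>r \<ge> 2\<close> enters, through
      \<open>4 \<le> r^2\<close>.\<close>
    also have "\<dots> \<le> r\<^sup>2 * r\<^sup>2"
      using power_mono[OF r, of 2] by (intro mult_left_mono) auto
    also have "\<dots> = r ^ 4"
      by (simp flip: power_add)
    finally show "card (A \<union> B \<union> C) \<le> r ^ 4" .
    show "\<bar>c j\<bar> \<le> 1" if "c \<in> A \<union> B \<union> C" for c j
      using that by (auto simp: A_def B_def C_def)
  next
    fix e :: "nat \<Rightarrow> real" and z :: complex and b
    assume z: "cmod z = 1" and b: "\<And>c. c \<in> A \<union> B \<union> C \<Longrightarrow> \<bar>\<Sum>j<r. c j * e j\<bar> \<le> b"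
    have eb: "\<bar>e i\<bar> \<le> b" if "i < r" for i
      using b[of "\<lambda>j. if i = j then 1 else 0"] that
      by (auto simp: C_def if_distrib[of "\<lambda>x. x * _"] cong: if_cong)
    have b0: "b \<ge> 0"
      using eb[of 0] r by simp
    define P where "P = (\<lambda>\<alpha>. \<Sum>j<r. complex_of_real (e j) * cis (real j * \<alpha>))"
    have grid: "cmod (P (\<theta> l)) \<le> 2 * b" if l: "l < N" for l
    proof -
      have "\<bar>Re (P (\<theta> l))\<bar> \<le> b"
        using b[of "\<lambda>j. cos (real j * \<theta> l)"] l by (auto simp: A_def P_def mult.commute)
      moreover have "\<bar>Im (P (\<theta> l))\<bar> \<le> b"
        using b[of "\<lambda>j. sin (real j * \<theta> l)"] l by (auto simp: B_def P_def mult.commute)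
      ultimately show ?thesis
        using cmod_le[of "P (\<theta> l)"] by linarith
    qed
    obtain \<alpha> where \<alpha>: "0 \<le> \<alpha>" "\<alpha> < 2 * pi" "inverse z = cis \<alpha>"
      using Arg2pi_ge_0[of "inverse z"] Arg2pi_lt_2pi[of "inverse z"] Arg2pi_eq[of "inverse z"] z
      by (metis cis_conv_exp mult_1 norm_inverse inverse_1 of_real_1)
    \<comment> \<open>The grid point \<open>\<theta> l\<close> is the last one not exceeding
      \<alpha>.\<close>
    define l where "l = nat \<lfloor>\<alpha> * real N / (2 * pi)\<rfloor>"
    have l: "real l \<le> \<alpha> * real N / (2 * pi)" "\<alpha> * real N / (2 * pi) < real l + 1"
      using \<alpha> by (auto simp: l_def of_nat_nat)
    have "\<alpha> * real N / (2 * pi) < real N"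
      using \<alpha> N by (simp add: field_simps)
    then have lN: "l < N"
      using l by linarith
    have dist: "\<bar>\<alpha> - \<theta> l\<bar> \<le> 2 * pi / real N"
    proof -
      have "\<alpha> - \<theta> l = (\<alpha> * real N / (2 * pi) - real l) * (2 * pi / real N)"
        using N by (simp add: \<theta>_def field_simps)
      moreover have "\<bar>\<alpha> * real N / (2 * pi) - real l\<bar> \<le> 1"
        using l by linarith
      ultimately show ?thesis
        using mult_right_mono[of _ 1 "2 * pi / real N"] by (simp add: abs_mult)
    qed
    have "cmod (P \<alpha> - P (\<theta> l))
        \<le> (\<Sum>j<r. cmod (complex_of_real (e j) * (cis (real j * \<alpha>) - cis (real j * \<theta> l))))"
      unfolding P_def by (simp add: right_diff_distrib norm_sum flip: sum_subtractf)
    also have "\<dots> \<le> (\<Sum>j<r. b * (real r * (2 * pi / real N)))"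
    proof (rule sum_mono)
      fix j assume j: "j \<in> {..<r}"
      have "cmod (cis (real j * \<alpha>) - cis (real j * \<theta> l)) \<le> real j * \<bar>\<alpha> - \<theta> l\<bar>"
        using cmod_cis_diff_le[of "real j * \<alpha>" "real j * \<theta> l"]
        by (simp add: abs_mult flip: right_diff_distrib)
      also have "\<dots> \<le> real r * (2 * pi / real N)"
        using j dist by (intro mult_mono) auto
      finally show "cmod (complex_of_real (e j) * (cis (real j * \<alpha>) - cis (real j * \<theta> l)))
          \<le> b * (real r * (2 * pi / real N))"
        unfolding norm_mult using j eb[of j] b0 by (intro mult_mono) auto
    qed
    also have "\<dots> = 2 * pi * b"
      using r by (simp add: N_def power2_eq_square)
    also have "\<dots> \<le> 7 * b"
      using b0 pi_approx(2) by (intro mult_right_mono) auto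
    \<comment> \<open>The 9 consists of 2 for the real and imaginary parts at the grid point and 7,
      an upper bound of \<open>2 * pi\<close>, for the variation.\<close>
    finally have "cmod (P \<alpha>) \<le> 9 * b"
      using grid[OF lN] norm_triangle_sub[of "P \<alpha>" "P (\<theta> l)"] by linarith
    moreover have "z powi (- int j) = cis (real j * \<alpha>)" for j
      using \<alpha>(3) by (simp add: power_int_minus power_inverse[symmetric] Complex.DeMoivre)
    ultimately show "cmod (\<Sum>j<r. complex_of_real (e j) * z powi (- int j)) \<le> 9 * b"
      by (simp add: P_def)
  qed
qed

text \<open>This is the noise term in \<open>least_squares_harmonic_inputs\<close>: the error in the
  estimate of \<open>g j\<close>, which depends on the noise but not on the system.\<close>

definition coeff_error :: "nat \<Rightarrow> nat \<Rightarrow> nat \<Rightarrow> (nat \<Rightarrow> nat \<Rightarrow> real) \<Rightarrow> real" where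
  "coeff_error n T j \<omega> =
     (\<Sum>p<T * (2 * n). stacked_Toep T (harmonic_inputs n T) $$ (p, j) * \<omega> (p div T) (p mod T))
       / (real n * real (T - j))"

lemma fir_estimate_harmonic_inputs:
  assumes "T \<le> n" "r \<le> T"
  shows "fir_estimate g r T (harmonic_inputs n T) \<omega> z
    = (\<Sum>k<r. complex_of_real (g k) * z powi (- int k))
      + (\<Sum>k<r. complex_of_real (coeff_error n T k \<omega>) * z powi (- int k))"
  unfolding fir_estimate_def fir_def sum.distrib[symmetric] using assms
  by (intro sum.cong refl)
    (simp add: least_squares_harmonic_inputs coeff_error_def distrib_right)

text \<open>Orthogonality of the columns removes the cross terms, leaving the sum of
  \<open>(c j)^2 / (n * (T - j))\<close> over \<open>j < r\<close>. Because
  \<open>T = 2 * r\<close>, every \<open>T - j\<close> is at least \<open>r\<close>, so each of the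
  \<open>r\<close> terms is at most \<open>1 / (n * r)\<close>.\<close>

lemma coeff_error_linear_form:
  assumes T: "T = 2 * r" "r \<ge> 1" "T \<le> n" and c: "\<And>j. \<bar>c j\<bar> \<le> 1"
  obtains w where "\<And>\<omega>. (\<Sum>j<r. c j * coeff_error n T j \<omega>) = (\<Sum>a<2 * n. \<Sum>t<T. w a t * \<omega> a t)"
    "(\<Sum>a<2 * n. \<Sum>t<T. (w a t)\<^sup>2) \<le> 1 / real n"
proof -
  define N where "N = T * (2 * n)"
  define Z where "Z = stacked_Toep T (harmonic_inputs n T)"
  define d where "d = (\<lambda>j. c j / (real n * real (T - j)))"
  define W where "W = (\<lambda>p. \<Sum>j<r. d j * Z $$ (p, j))"
  define w where "w = (\<lambda>a t. W (a * T + t))"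
  have n: "n > 0"
    using T by linarith
  have Ww: "W p = w (p div T) (p mod T)" for p
    by (simp add: w_def)
  have "(\<Sum>j<r. c j * coeff_error n T j \<omega>) = (\<Sum>a<2 * n. \<Sum>t<T. w a t * \<omega> a t)" for \<omega>
  proof -
    have "(\<Sum>j<r. c j * coeff_error n T j \<omega>)
        = (\<Sum>j<r. \<Sum>p<N. d j * Z $$ (p, j) * \<omega> (p div T) (p mod T))"
      by (simp add: coeff_error_def N_def Z_def d_def sum_distrib_left sum_divide_distrib mult.assoc)
    also have "\<dots> = (\<Sum>p<N. W p * \<omega> (p div T) (p mod T))"
      unfolding W_def sum_distrib_right by (rule sum.swap)
    also have "\<dots> = (\<Sum>a<2 * n. \<Sum>t<T. w a t * \<omega> a t)"
      unfolding Ww N_def by (rule sum_lessThan_mult)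
    finally show ?thesis .
  qed
  moreover have "(\<Sum>a<2 * n. \<Sum>t<T. (w a t)\<^sup>2) \<le> 1 / real n"
  proof -
    have "(\<Sum>a<2 * n. \<Sum>t<T. (w a t)\<^sup>2) = (\<Sum>p<N. (W p)\<^sup>2)"
      unfolding Ww N_def by (rule sum_lessThan_mult[symmetric])
    also have "\<dots> = (\<Sum>p<N. \<Sum>j<r. \<Sum>k<r. d j * d k * (Z $$ (p, j) * Z $$ (p, k)))"
      by (simp add: W_def power2_eq_square sum_product mult_ac)
    also have "\<dots> = (\<Sum>j<r. \<Sum>k<r. \<Sum>p<N. d j * d k * (Z $$ (p, j) * Z $$ (p, k)))"
      by (subst sum.swap) (intro sum.cong refl sum.swap)
    also have "\<dots> = (\<Sum>j<r. \<Sum>k<r. if j = k then (d j)\<^sup>2 * (real n * real (T - j)) else 0)"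
    proof (intro sum.cong refl)
      fix j k assume "j \<in> {..<r}" "k \<in> {..<r}"
      then show "(\<Sum>p<N. d j * d k * (Z $$ (p, j) * Z $$ (p, k)))
          = (if j = k then (d j)\<^sup>2 * (real n * real (T - j)) else 0)"
        using Gram_harmonic_inputs[OF T(3), of j k] T
        by (simp add: Z_def N_def power2_eq_square flip: sum_distrib_left)
    qed
    also have "\<dots> = (\<Sum>j<r. (d j)\<^sup>2 * (real n * real (T - j)))"
      by (intro sum.cong) auto
    also have "\<dots> \<le> (\<Sum>j<r. 1 / (real n * real r))"
    proof (rule sum_mono)
      fix j assume j: "j \<in> {..<r}"
      have "(d j)\<^sup>2 * (real n * real (T - j)) = (c j)\<^sup>2 / (real n * real (T - j))"
        using n j T by (simp add: d_def power2_eq_square)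
      also have "\<dots> \<le> 1 / (real n * real r)"
        using n j T c[of j] by (intro frac_le mult_left_mono) (auto simp: abs_square_le_1)
      finally show "(d j)\<^sup>2 * (real n * real (T - j)) \<le> 1 / (real n * real r)" .
    qed
    also have "\<dots> = 1 / real n"
      using T by simp
    finally show ?thesis .
  qed
  ultimately show thesis
    using that by blast
qed

section \<open>Measurability and probability of the error event\<close>

lemma coeff_error_measurable:
  "coeff_error n T j \<in> borel_measurable (noise_law (2 * n) T \<sigma>)"
proof -
  have "(\<lambda>\<omega>. \<omega> (p div T) (p mod T)) \<in> borel_measurable (noise_law (2 * n) T \<sigma>)"
    if "p < T * (2 * n)" for p
  proof (rule noise_law_component_measurable)
    show "p div T < 2 * n"
      using that by (simp add: less_mult_imp_div_less mult.commute)
    show "p mod T < T"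
      using that by (cases T) auto
  qed
  then show ?thesis
    unfolding coeff_error_def[abs_def]
    by (intro borel_measurable_divide borel_measurable_sum borel_measurable_times
        borel_measurable_const) auto
qed

text \<open>By continuity the supremum over the circle may be tested on a countable dense subset,
  which makes the event a countable intersection.\<close>

lemma hinf_norm_event_measurable:
  assumes cont: "\<And>\<omega>. continuous_on (sphere 0 1) (H \<omega>)"
    and meas: "\<And>z. (\<lambda>\<omega>. H \<omega> z) \<in> borel_measurable M"
  shows "{\<omega> \<in> space M. hinf_norm (H \<omega>) \<le> b} \<in> sets M"
proof -
  obtain D :: "complex set" where D: "countable D" "D \<subseteq> sphere 0 1" "sphere 0 1 \<subseteq> closure D"
    using separable[of "sphere (0::complex) 1"] by blast
  have clD: "closure D = sphere 0 1"
    using D by (metis closed_sphere closure_minimal subset_antisym)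
  have "hinf_norm (H \<omega>) \<le> b \<longleftrightarrow> (\<forall>z\<in>D. cmod (H \<omega> z) \<le> b)" for \<omega>
  proof -
    have "cmod (H \<omega> z) \<le> b" if "z \<in> sphere 0 1" "\<forall>z\<in>D. cmod (H \<omega> z) \<le> b" for z
    proof (rule continuous_le_on_closure[of D "\<lambda>z. cmod (H \<omega> z)"])
      show "continuous_on (closure D) (\<lambda>z. cmod (H \<omega> z))"
        unfolding clD by (rule continuous_on_norm[OF cont])
    qed (use that clD in auto)
    then show ?thesis
      unfolding hinf_norm_le_iff[OF cont] using D(2) by blast
  qed
  then have "{\<omega> \<in> space M. hinf_norm (H \<omega>) \<le> b} = {\<omega> \<in> space M. \<forall>z\<in>D. cmod (H \<omega> z) \<le> b}"
    by simp
  also have "\<dots> \<in> sets M"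
    using D(1) meas by measurable
  finally show ?thesis .
qed

lemma hinf_norm_error_probability:
  fixes \<epsilon> \<delta> \<sigma> \<rho> :: real
  assumes \<epsilon>: "\<epsilon> > 0" and \<delta>: "0 < \<delta>" "\<delta> < 1" and \<sigma>: "\<sigma> > 0" and \<rho>: "0 < \<rho>" "\<rho> < 1"
    and G: "stable_system G g \<rho>" and r: "r \<ge> 1"
    and len: "sufficient_length G \<rho> (\<epsilon> / 2) \<le> ereal (real r)" and T: "T = 2 * r" "T \<le> n"
    and n: "real (2 * n) \<ge> 5184 * (\<sigma>\<^sup>2 / \<epsilon>\<^sup>2) * (ln (real r) + ln (1 / \<delta>))"
  shows "measure (noise_law (2 * n) T \<sigma>) {\<omega> \<in> space (noise_law (2 * n) T \<sigma>).
      hinf_norm (\<lambda>z. G z - fir_estimate g r T (harmonic_inputs n T) \<omega> z) \<le> \<epsilon>} \<ge> 1 - \<delta>"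
proof -
  define M where "M = noise_law (2 * n) T \<sigma>"
  define H where "H = (\<lambda>\<omega> z. G z - fir_estimate g r T (harmonic_inputs n T) \<omega> z)"
  \<comment> \<open>With this threshold the noise polynomial is at most
    \<open>9 * x = \<epsilon> / 2\<close>; the other half of \<epsilon> pays for the
    truncation.\<close>
  define x where "x = \<epsilon> / 18"
  interpret prob_space M
    unfolding M_def by (rule prob_space_gaussian_noise[OF \<sigma>])
  have n0: "n > 0"
    using r T by linarith
  have H_eq: "H \<omega> z = (G z - (\<Sum>k<r. complex_of_real (g k) * z powi (- int k)))
      - (\<Sum>k<r. complex_of_real (coeff_error n T k \<omega>) * z powi (- int k))" for \<omega> z
    unfolding H_def using T by (simp add: fir_estimate_harmonic_inputs)
  have cont: "continuous_on (sphere 0 1) (H \<omega>)" for \<omega>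
  proof -
    have "continuous_on (sphere 0 1) G"
      using \<rho> by (intro stable_system_continuous_on[OF G]) auto
    then show ?thesis
      unfolding H_eq[abs_def] by (intro continuous_intros) auto
  qed
  have "(\<lambda>\<omega>. H \<omega> z) \<in> borel_measurable M" for z
    unfolding H_eq M_def
    by (intro borel_measurable_diff borel_measurable_const borel_measurable_sum
        borel_measurable_times measurable_compose[OF coeff_error_measurable]) auto
  then have event: "{\<omega> \<in> space M. hinf_norm (H \<omega>) \<le> \<epsilon>} \<in> sets M"
    by (rule hinf_norm_event_measurable[OF cont])
  obtain F :: "(nat \<Rightarrow> real) set" where F: "finite F" "card F \<le> r ^ 4"
    "\<And>c j. c \<in> F \<Longrightarrow> \<bar>c j\<bar> \<le> 1"
    "\<And>e z b. cmod z = 1 \<Longrightarrow> (\<And>c. c \<in> F \<Longrightarrow> \<bar>\<Sum>j<r. c j * e j\<bar> \<le> b) \<Longrightarrow>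
       cmod (\<Sum>j<r. complex_of_real (e j) * z powi (- int j)) \<le> 9 * b"
    by (rule norming_family[OF r]) (rule that; blast)
  define Bad where "Bad = (\<lambda>c. {\<omega> \<in> space M. \<bar>\<Sum>j<r. c j * coeff_error n T j \<omega>\<bar> > x})"
  have Bad_sets: "Bad c \<in> sets M" for c
  proof -
    have "(\<lambda>\<omega>. \<Sum>j<r. c j * coeff_error n T j \<omega>) \<in> borel_measurable M"
      unfolding M_def
      by (intro borel_measurable_sum borel_measurable_times borel_measurable_const
          coeff_error_measurable)
    then show ?thesis
      unfolding Bad_def by measurable
  qed
  have Bad_prob: "prob (Bad c) \<le> (\<delta> / real r) ^ 4" if c: "c \<in> F" for c
  proof -
    obtain w where w: "\<And>\<omega>. (\<Sum>j<r. c j * coeff_error n T j \<omega>) = (\<Sum>a<2 * n. \<Sum>t<T. w a t * \<omega> a t)"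
      "(\<Sum>a<2 * n. \<Sum>t<T. (w a t)\<^sup>2) \<le> 1 / real n"
      by (rule coeff_error_linear_form[where c = c, OF T(1) r T(2) F(3)[OF c]]) blast
    have "prob (Bad c) \<le> exp (- x\<^sup>2 / (2 * (\<sigma>\<^sup>2 / real n)))"
      unfolding Bad_def w(1) M_def
    proof (rule linear_form_noise_tail[OF \<sigma>])
      show "\<sigma>\<^sup>2 * (\<Sum>a<2 * n. \<Sum>t<T. (w a t)\<^sup>2) \<le> \<sigma>\<^sup>2 / real n"
        using mult_left_mono[OF w(2), of "\<sigma>\<^sup>2"] by simp
    qed (use \<epsilon> \<sigma> n0 in \<open>auto simp: x_def\<close>)
    also have "\<dots> \<le> exp (- 4 * (ln (real r) + ln (1 / \<delta>)))"
    proof -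
      \<comment> \<open>The right side equals \<open>n * \<epsilon>^2 / (648 * \<sigma>^2)\<close>.
        Requiring it to be at least four times the logarithmic term amounts to the constant
        \<open>5184 = 8 * 648\<close> for \<open>2 * n\<close>.\<close>
      have "4 * (ln (real r) + ln (1 / \<delta>)) \<le> x\<^sup>2 / (2 * (\<sigma>\<^sup>2 / real n))"
        using n \<epsilon> \<sigma> by (simp add: x_def power_divide field_simps)
      then show ?thesis
        by simp
    qed
    also have "\<dots> = exp (4 * ln (\<delta> / real r))"
      using \<delta> r by (simp add: ln_div)
    also have "\<dots> = (\<delta> / real r) ^ 4"
      using \<delta> r exp_of_nat_mult[of 4 "ln (\<delta> / real r)"] by simp
    finally show ?thesis .
  qed
  have "prob (\<Union>c\<in>F. Bad c) \<le> (\<Sum>c\<in>F. prob (Bad c))"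
    using F(1) Bad_sets by (intro finite_measure_subadditive_finite) auto
  also have "\<dots> \<le> real (card F) * (\<delta> / real r) ^ 4"
    using sum_mono[of F "\<lambda>c. prob (Bad c)" "\<lambda>_. (\<delta> / real r) ^ 4"] Bad_prob by simp
  \<comment> \<open>The exponent 4 makes the size of the family cancel, leaving
    \<open>\<delta>^4 \<le> \<delta>\<close>.\<close>
  also have "\<dots> \<le> real (r ^ 4) * (\<delta> / real r) ^ 4"
    using F(2) \<delta> by (intro mult_right_mono) (auto simp del: of_nat_power)
  also have "\<dots> = \<delta> ^ 4"
    using r by (simp add: power_divide)
  also have "\<dots> \<le> \<delta>"
    using \<delta> power_decreasing[of 1 4 \<delta>] by simp
  finally have "prob (\<Union>c\<in>F. Bad c) \<le> \<delta>" .
  then have "1 - \<delta> \<le> prob (space M - (\<Union>c\<in>F. Bad c))"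
    using F(1) Bad_sets by (subst prob_compl) auto
  also have "\<dots> \<le> prob {\<omega> \<in> space M. hinf_norm (H \<omega>) \<le> \<epsilon>}"
  proof (rule finite_measure_mono[OF _ event], safe)
    fix \<omega> assume \<omega>: "\<omega> \<in> space M" "\<omega> \<notin> (\<Union>c\<in>F. Bad c)"
    show "hinf_norm (H \<omega>) \<le> \<epsilon>"
      unfolding hinf_norm_le_iff[OF cont]
    proof
      fix z :: complex assume "z \<in> sphere 0 1"
      then have z: "cmod z = 1"
        by simp
      have "cmod (\<Sum>k<r. complex_of_real (coeff_error n T k \<omega>) * z powi (- int k)) \<le> 9 * x"
        using \<omega> by (intro F(4)[OF z]) (force simp: Bad_def)
      moreover have "cmod (G z - (\<Sum>k<r. complex_of_real (g k) * z powi (- int k))) \<le> \<epsilon> / 2"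
        using \<epsilon> by (intro truncation_error_le[OF G \<rho>(1) z _ len]) simp
      ultimately show "cmod (H \<omega> z) \<le> \<epsilon>"
        unfolding H_eq by (intro norm_triangle_le_diff) (simp add: x_def)
    qed
  qed
  finally show ?thesis
    by (simp add: M_def H_def)
qed

theorem theorem1p3:
  shows "\<exists>C::real. C > 0 \<and>
    (\<forall>(\<epsilon>::real) (\<delta>::real) (\<sigma>::real) (\<rho>::real) (G::complex \<Rightarrow> complex) (g::nat \<Rightarrow> real)
       (r::nat) (T::nat) (m::nat) (n::nat).
      \<epsilon> > 0 \<longrightarrow> 0 < \<delta> \<longrightarrow> \<delta> < 1 \<longrightarrow> \<sigma> > 0 \<longrightarrow> 0 < \<rho> \<longrightarrow> \<rho> < 1 \<longrightarrow>
      stable_system G g \<rho> \<longrightarrow>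
      r \<ge> 1 \<longrightarrow> ereal (real r) \<ge> sufficient_length G \<rho> (\<epsilon> / 2) \<longrightarrow>
      T = 2 * r \<longrightarrow> m = 2 * n \<longrightarrow> m \<ge> 4 * r \<longrightarrow>
      real m \<ge> C * (\<sigma>\<^sup>2 / \<epsilon>\<^sup>2) * (ln (real r) + ln (1 / \<delta>)) \<longrightarrow>
      set (harmonic_inputs n T) \<subseteq> linf_ball T \<and>
      measure (noise_law m T \<sigma>)
        {\<omega> \<in> space (noise_law m T \<sigma>).
           hinf_norm (\<lambda>z. G z - fir_estimate g r T (harmonic_inputs n T) \<omega> z) \<le> \<epsilon>}
        \<ge> 1 - \<delta>)"
proof (intro exI[of _ 5184] conjI allI impI harmonic_inputs_subset)
  fix \<epsilon> \<delta> \<sigma> \<rho> :: real and G g and r T m n :: nat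
  assume "\<epsilon> > 0" "0 < \<delta>" "\<delta> < 1" "\<sigma> > 0" "0 < \<rho>" "\<rho> < 1" "stable_system G g \<rho>" "r \<ge> 1"
    "ereal (real r) \<ge> sufficient_length G \<rho> (\<epsilon> / 2)" "T = 2 * r" "m = 2 * n" "m \<ge> 4 * r"
    "real m \<ge> 5184 * (\<sigma>\<^sup>2 / \<epsilon>\<^sup>2) * (ln (real r) + ln (1 / \<delta>))"
  then show "measure (noise_law m T \<sigma>) {\<omega> \<in> space (noise_law m T \<sigma>).
      hinf_norm (\<lambda>z. G z - fir_estimate g r T (harmonic_inputs n T) \<omega> z) \<le> \<epsilon>} \<ge> 1 - \<delta>"
    \<comment> \<open>From \<open>m = 2 * n\<close> and \<open>m \<ge> 4 * r\<close> follows
      \<open>T \<le> n\<close>, the condition for orthogonality.\<close>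
    using hinf_norm_error_probability[of \<epsilon> \<delta> \<sigma> \<rho> G g r T n] by simp
qed simp

end
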